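(* Let $\Phi^n\in\mathcal{M}_h$ be generated from $\Phi^0\in\mathcal{M}_h$ by the stabilized fully-discrete semi-implicit scheme $$\Big(\frac1\tau+\frac{\kappa_h}{\epsilon}\Big)(\Phi^{n+1}-\Phi^n)=\epsilon\Delta_h\Phi^{n+1}-\frac1\epsilon W'(\Phi^n)-\gamma\big[(-\Delta_h)^{-1}(f(\Phi^n)-\omega)\big]\odot f'(\Phi^n)-M\langle f(\Phi^n)-\omega,1\rangle_h\,f'(\Phi^n),$$ and assume $0\le\Phi^0\le1$. If $$\frac{\kappa_h}{\epsilon}\ \ge\ \frac{L_{W''}}{\epsilon}+(L_{f'}^2+\tilde\omega L_{f''})\Big(\gamma\|(-\Delta_h)^{-1}\|+M|\mathbb{T}^2|\Big),$$ then the scheme is unconditionally energy stable: for every time step size $\tau>0$ and every $n$, $$E_h^{\mathrm{pOK}}[\Phi^{n+1}]\le E_h^{\mathrm{pOK}}[\Phi^n].$$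
   Context: $\mathbb{T}^2=\prod_{i=1}^2[-X_i,X_i]$ is a periodic box; $N_1,N_2$ are positive even integers, $h_i=2X_i/N_i$, $\mathbb{T}^2_h=\mathbb{T}^2\cap(h_1\mathbb{Z}\times h_2\mathbb{Z})$, $S_h=\{(k_1,k_2)\in\mathbb{Z}^2:1\le k_i\le N_i\}$, and $\mathcal{M}_h$ is the space of real periodic grid functions ($u_{k_1+m_1N_1,k_2+m_2N_2}=u_{k_1,k_2}$ for all $m_1,m_2\in\mathbb{Z}$). $\langle u,v\rangle_h=h_1h_2\sum_{(i,j)\in S_h}u_{ij}v_{ij}$, $\|u\|_{h,L^\infty}=\max_{S_h}|u_{ij}|$. $(\Delta_hu)_{ij}=h_1^{-2}(u_{i-1,j}-2u_{ij}+u_{i+1,j})+h_2^{-2}(u_{i,j-1}-2u_{ij}+u_{i,j+1})$ with periodic indices. $\Delta_h$ is invertible on mean-zero grid functions; for $g\in\mathcal{M}_h$, $(-\Delta_h)^{-1}g$ denotes the mean-zero $u$ with $-\Delta_hu=g-\frac{1}{|\mathbb{T}^2|}\langle g,1\rangle_h$. $\|(-\Delta_h)^{-1}\|$ is the optimal $C$ in $\|(-\Delta_h)^{-1}g\|_{h,L^\infty}\le C\|g\|_{h,L^\infty}$, $g\in\mathcal{M}_h$. $\odot$ is pointwise multiplication; $W,W',f,f'$ act pointwise; inequalities between grid functions and constants are pointwise. The parameters are $\epsilon>0$, $\gamma>0$, $M>0$, $\kappa_h>0$, $\omega\in(0,1)$, $\tilde\omega=\max\{\omega,1-\omega\}$;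 $T>0$, $N>0$ is an integer, $\tau=T/N$, $n$ ranges over $0,\dots,N-1$. $W(s)=18(s^2-s)^2$, $f(s)=3s^2-2s^3$, $L_{W''}=\|W''\|_{L^\infty[0,1]}$, $L_{f'}=\|f'\|_{L^\infty[0,1]}$, $L_{f''}=\|f''\|_{L^\infty[0,1]}$. The discrete energy is $$E_h^{\mathrm{pOK}}[\Phi]=-\frac\epsilon2\langle\Delta_h\Phi,\Phi\rangle_h+\frac1\epsilon\langle W(\Phi),1\rangle_h+\frac\gamma2\big\langle(-\Delta_h)^{-1}(f(\Phi)-\omega),f(\Phi)-\omega\big\rangle_h+\frac M2\big(\langle f(\Phi)-\omega,1\rangle_h\big)^2.$$ *)

theory Defs
  imports "HOL-Analysis.Analysis"
begin

text \<open>
  A grid function is given by its values \<open>u i j\<close> at all integer index pairs, so that periodic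
  indices need no separate treatment. The box has half-widths \<open>X1, X2\<close>, and there are \<open>N1, N2\<close>
  grid cells per period.
\<close>

type_synonym grid_fun = "int \<Rightarrow> int \<Rightarrow> real"

definition periodic_grid_funs :: "nat \<Rightarrow> nat \<Rightarrow> grid_fun set" where
  "periodic_grid_funs N1 N2 =
     {u. \<forall>k1 k2 m1 m2. u (k1 + m1 * int N1) (k2 + m2 * int N2) = u k1 k2}"

definition index_set :: "nat \<Rightarrow> nat \<Rightarrow> (int \<times> int) set" where
  "index_set N1 N2 = {1..int N1} \<times> {1..int N2}"

definition mesh_size :: "real \<Rightarrow> nat \<Rightarrow> real" where
  "mesh_size X N = 2 * X / real N"

definition box_area :: "real \<Rightarrow> real \<Rightarrow> real" where
  "box_area X1 X2 = measure lborel ({-X1..X1} \<times> {-X2..X2})"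

definition grid_inner :: "real \<Rightarrow> real \<Rightarrow> nat \<Rightarrow> nat \<Rightarrow> grid_fun \<Rightarrow> grid_fun \<Rightarrow> real" where
  "grid_inner X1 X2 N1 N2 u v =
     mesh_size X1 N1 * mesh_size X2 N2 * (\<Sum>(i, j)\<in>index_set N1 N2. u i j * v i j)"

definition grid_max_norm :: "nat \<Rightarrow> nat \<Rightarrow> grid_fun \<Rightarrow> real" where
  "grid_max_norm N1 N2 u = Max ((\<lambda>(i, j). \<bar>u i j\<bar>) ` index_set N1 N2)"

definition grid_laplacian :: "real \<Rightarrow> real \<Rightarrow> nat \<Rightarrow> nat \<Rightarrow> grid_fun \<Rightarrow> grid_fun" where
  "grid_laplacian X1 X2 N1 N2 u = (\<lambda>i j.
       (u (i - 1) j - 2 * u i j + u (i + 1) j) / (mesh_size X1 N1)\<^sup>2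
     + (u i (j - 1) - 2 * u i j + u i (j + 1)) / (mesh_size X2 N2)\<^sup>2)"

definition inv_neg_laplacian :: "real \<Rightarrow> real \<Rightarrow> nat \<Rightarrow> nat \<Rightarrow> grid_fun \<Rightarrow> grid_fun" where
  "inv_neg_laplacian X1 X2 N1 N2 g = (THE u.
       u \<in> periodic_grid_funs N1 N2 \<and>
       grid_inner X1 X2 N1 N2 u (\<lambda>_ _. 1) = 0 \<and>
       (\<forall>i j. - grid_laplacian X1 X2 N1 N2 u i j
              = g i j - grid_inner X1 X2 N1 N2 g (\<lambda>_ _. 1) / box_area X1 X2))"

text \<open>
  The optimal constant. Every admissible \<open>C\<close> is nonnegative (take \<open>g = 1\<close>), so the infimum is
  taken over a set that is bounded below.
\<close>

definition inv_neg_laplacian_norm :: "real \<Rightarrow> real \<Rightarrow> nat \<Rightarrow> nat \<Rightarrow> real" where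
  "inv_neg_laplacian_norm X1 X2 N1 N2 = Inf {C. \<forall>g\<in>periodic_grid_funs N1 N2.
     grid_max_norm N1 N2 (inv_neg_laplacian X1 X2 N1 N2 g) \<le> C * grid_max_norm N1 N2 g}"

definition W_fun :: "real \<Rightarrow> real" where
  "W_fun s = 18 * (s\<^sup>2 - s)\<^sup>2"

definition f_fun :: "real \<Rightarrow> real" where
  "f_fun s = 3 * s\<^sup>2 - 2 * s ^ 3"

text \<open>
  The \<open>L\<^sup>\<infinity>[0,1]\<close> norm, as a supremum. It is applied to polynomials only, for which the
  supremum and the essential supremum agree.
\<close>

definition sup_norm_01 :: "(real \<Rightarrow> real) \<Rightarrow> real" where
  "sup_norm_01 g = (SUP s\<in>{0..1}. \<bar>g s\<bar>)"

definition pOK_energy ::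
  "real \<Rightarrow> real \<Rightarrow> nat \<Rightarrow> nat \<Rightarrow> real \<Rightarrow> real \<Rightarrow> real \<Rightarrow> real \<Rightarrow> grid_fun \<Rightarrow> real" where
  "pOK_energy X1 X2 N1 N2 \<epsilon> \<gamma> M \<omega> \<Phi> =
     - (\<epsilon> / 2) * grid_inner X1 X2 N1 N2 (grid_laplacian X1 X2 N1 N2 \<Phi>) \<Phi>
     + 1 / \<epsilon> * grid_inner X1 X2 N1 N2 (\<lambda>i j. W_fun (\<Phi> i j)) (\<lambda>_ _. 1)
     + \<gamma> / 2 * grid_inner X1 X2 N1 N2
         (inv_neg_laplacian X1 X2 N1 N2 (\<lambda>i j. f_fun (\<Phi> i j) - \<omega>)) (\<lambda>i j. f_fun (\<Phi> i j) - \<omega>)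
     + M / 2 * (grid_inner X1 X2 N1 N2 (\<lambda>i j. f_fun (\<Phi> i j) - \<omega>) (\<lambda>_ _. 1))\<^sup>2"

text \<open>One step of the scheme with step size \<open>\<tau>\<close>, from \<open>\<Phi>\<close> to \<open>\<Psi>\<close>; it is implicit in \<open>\<Psi>\<close>.\<close>

definition pOK_step ::
  "real \<Rightarrow> real \<Rightarrow> nat \<Rightarrow> nat \<Rightarrow> real \<Rightarrow> real \<Rightarrow> real \<Rightarrow> real \<Rightarrow> real \<Rightarrow> real
    \<Rightarrow> grid_fun \<Rightarrow> grid_fun \<Rightarrow> bool" where
  "pOK_step X1 X2 N1 N2 \<epsilon> \<gamma> M \<omega> \<kappa> \<tau> \<Phi> \<Psi> \<longleftrightarrow> (\<forall>i j.
     (1 / \<tau> + \<kappa> / \<epsilon>) * (\<Psi> i j - \<Phi> i j) =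
       \<epsilon> * grid_laplacian X1 X2 N1 N2 \<Psi> i j
       - 1 / \<epsilon> * deriv W_fun (\<Phi> i j)
       - \<gamma> * inv_neg_laplacian X1 X2 N1 N2 (\<lambda>i j. f_fun (\<Phi> i j) - \<omega>) i j * deriv f_fun (\<Phi> i j)
       - M * grid_inner X1 X2 N1 N2 (\<lambda>i j. f_fun (\<Phi> i j) - \<omega>) (\<lambda>_ _. 1) * deriv f_fun (\<Phi> i j))"

end

theory Submission
  imports Defs "HOL-Library.Function_Algebras"
begin

text \<open>
  Write \<open>D\<close> for the increment of one step and \<open>F\<close> for the increment of \<open>f(\<Phi>)\<close>.

  The scheme preserves the range \<open>[0,1]\<close>. If \<open>0 \<le> \<Phi> \<le> 1\<close>, then \<open>f(\<Phi>) - \<omega>\<close> is bounded by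
  \<open>max \<omega> (1 - \<omega>)\<close>, and so the nonlocal coefficient
  \<open>\<gamma> (-\<Delta>)\<^sup>-\<^sup>1(f(\<Phi>) - \<omega>) + M \<langle>f(\<Phi>) - \<omega>, 1\<rangle>\<close> is bounded by
  \<open>max \<omega> (1 - \<omega>)\<close> times \<open>\<gamma> \<parallel>(-\<Delta>)\<^sup>-\<^sup>1\<parallel> + M |T\<^sup>2|\<close>. The stability condition then makes the explicit part
  a nondecreasing function of the value of \<open>\<Phi>\<close>, so that it lies between \<open>0\<close> and
  \<open>1/\<tau> + \<kappa>/\<epsilon>\<close> (\<open>explicit_term_in_range\<close>); the discrete maximum principle
  (\<open>discrete_max_principle\<close>) gives \<open>0 \<le> \<Psi> \<le> 1\<close> for the new state \<open>\<Psi>\<close>.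

  Both states being in \<open>[0,1]\<close>, Taylor's formula bounds the increments of \<open>W\<close> and \<open>f\<close> by their linear
  parts plus multiples of \<open>D\<^sup>2\<close>, while the Dirichlet energy is convex and treated implicitly. Testing
  the scheme with \<open>D\<close> cancels all linear parts. The quadratic rest contains
  \<open>\<langle>(-\<Delta>)\<^sup>-\<^sup>1F, F\<rangle>\<close> and \<open>\<langle>F, 1\<rangle>\<^sup>2\<close>; the latter is handled by the Cauchy-Schwarz inequality.
  For the former, the norm of \<open>(-\<Delta>)\<^sup>-\<^sup>1\<close> that enters the stability condition refers to the maximum
  norm, and the Schur test shows that for this symmetric operator it also bounds the quadratic form
  (\<open>ip_G_self_le\<close>). Altogether the energy changes by at most
  \<open>-(1/\<tau> + \<kappa>/(2\<epsilon>)) \<parallel>D\<parallel>\<^sup>2\<close>.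

  The properties of \<open>(-\<Delta>)\<^sup>-\<^sup>1\<close> rest on the unique solvability of the discrete Poisson equation:
  uniqueness comes from summation by parts, existence from finite dimension.
\<close>

section \<open>Linear algebra and the Schur test\<close>

text \<open>
  The finite-dimensional Fredholm alternative, for the span of a finite set in a space that need not
  have finite dimension itself.
\<close>

lemma (in vector_space) linear_inj_on_span_imp_surj:
  assumes "finite B" and lin: "Vector_Spaces.linear scale scale f"
    and into: "f ` span B \<subseteq> span B" and inj: "inj_on f (span B)"
  shows "f ` span B = span B"
proof -
  interpret f: Vector_Spaces.linear scale scale f by (fact lin)
  obtain C where C: "C \<subseteq> B" "independent C" "span C = span B"
    using maximal_independent_subset[of B] span_subspace[of _ "span B"]
    by (metis (no_types) span_eq span_superset subset_trans)
  have "finite C" using C(1) \<open>finite B\<close> by (rule finite_subset)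
  have ind: "independent (f ` C)"
    using f.independent_injective_image[OF C(2)] inj C(3) by simp
  have sub: "f ` C \<subseteq> span C"
    using into C(3) span_superset[of C] by auto
  have card: "card (f ` C) = card C"
    using inj C(3) span_superset[of C] by (metis card_image inj_on_subset)
  have "span C \<subseteq> span (f ` C)"
  proof
    fix v assume v: "v \<in> span C"
    show "v \<in> span (f ` C)"
    proof (rule ccontr)
      assume nv: "v \<notin> span (f ` C)"
      then have "independent (insert v (f ` C))"
        using ind by (simp add: independent_insert)
      then have "card (insert v (f ` C)) \<le> card C"
        using independent_span_bound[OF \<open>finite C\<close>] v sub by auto
      moreover have "v \<notin> f ` C" using nv span_superset by blast
      ultimately show False using card \<open>finite C\<close> by simp
    qed
  qed
  then show ?thesis using into C(3) f.span_image[of C] by auto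
qed

text \<open>
  The Schur test: by symmetry, the bound on the row sums, which is a bound in the maximum norm, is a
  bound for the quadratic form as well.
\<close>

lemma schur_test_symmetric:
  fixes k :: "'a \<Rightarrow> 'a \<Rightarrow> real"
  assumes symm: "\<And>p q. p \<in> A \<Longrightarrow> q \<in> A \<Longrightarrow> k p q = k q p"
    and row: "\<And>q. q \<in> A \<Longrightarrow> (\<Sum>p\<in>A. \<bar>k p q\<bar>) \<le> L"
  shows "(\<Sum>q\<in>A. (\<Sum>p\<in>A. F p * k p q) * F q) \<le> L * (\<Sum>q\<in>A. F q * F q)"
proof -
  have pt: "F p * k p q * F q \<le> \<bar>k p q\<bar> * (F p * F p) / 2 + \<bar>k p q\<bar> * (F q * F q) / 2" for p q
  proof -
    have "\<bar>F p * F q\<bar> \<le> (F p * F p + F q * F q) / 2"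
      using zero_le_power2[of "F p - F q"] zero_le_power2[of "F p + F q"]
      by (simp add: power2_eq_square algebra_simps abs_le_iff)
    have "F p * k p q * F q \<le> \<bar>k p q\<bar> * \<bar>F p * F q\<bar>"
      using abs_ge_self[of "F p * k p q * F q"] by (simp add: abs_mult mult_ac)
    also have "\<dots> \<le> \<bar>k p q\<bar> * ((F p * F p + F q * F q) / 2)"
      using \<open>\<bar>F p * F q\<bar> \<le> _\<close> by (rule mult_left_mono) simp
    finally show ?thesis by (simp add: distrib_left add_divide_distrib)
  qed
  have "(\<Sum>q\<in>A. (\<Sum>p\<in>A. F p * k p q) * F q)
      \<le> (\<Sum>q\<in>A. \<Sum>p\<in>A. \<bar>k p q\<bar> * (F p * F p) / 2 + \<bar>k p q\<bar> * (F q * F q) / 2)"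
    unfolding sum_distrib_right by (intro sum_mono pt)
  also have "\<dots> = (\<Sum>q\<in>A. \<Sum>p\<in>A. \<bar>k p q\<bar> * (F p * F p) / 2)
      + (\<Sum>q\<in>A. \<Sum>p\<in>A. \<bar>k p q\<bar> * (F q * F q) / 2)"
    by (simp add: sum.distrib)
  also have "(\<Sum>q\<in>A. \<Sum>p\<in>A. \<bar>k p q\<bar> * (F p * F p) / 2)
      = (\<Sum>p\<in>A. \<Sum>q\<in>A. \<bar>k q p\<bar> * (F p * F p) / 2)"
    by (subst sum.swap) (auto intro!: sum.cong simp: symm)
  also have "\<dots> + (\<Sum>q\<in>A. \<Sum>p\<in>A. \<bar>k p q\<bar> * (F q * F q) / 2)
      = (\<Sum>q\<in>A. (\<Sum>p\<in>A. \<bar>k p q\<bar>) * (F q * F q))"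
    by (simp add: sum_divide_distrib[symmetric] sum_distrib_right[symmetric])
  also have "\<dots> \<le> (\<Sum>q\<in>A. L * (F q * F q))"
    by (intro sum_mono mult_right_mono row) auto
  finally show ?thesis by (simp add: sum_distrib_left)
qed

section \<open>Periodic sequences\<close>

lemma sum_shift_period:
  fixes g :: "int \<Rightarrow> real"
  assumes "n > 0" and per: "\<And>i. g (i + int n) = g i"
  shows "(\<Sum>i\<in>{1..int n}. g (i + 1)) = (\<Sum>i\<in>{1..int n}. g i)"
proof -
  have "(\<Sum>i\<in>{1..int n}. g (i + 1)) = (\<Sum>i\<in>{2..int n + 1}. g i)"
    by (rule sum.reindex_bij_witness[of _ "\<lambda>i. i - 1" "\<lambda>i. i + 1"]) auto
  also have "{2..int n + 1} = insert (1 + int n) {2..int n}"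
    using \<open>n > 0\<close> by auto
  also have "(\<Sum>i\<in>insert (1 + int n) {2..int n}. g i) = (\<Sum>i\<in>insert 1 {2..int n}. g i)"
    using per[of 1] by simp
  also have "insert 1 {2..int n} = {1..int n}"
    using \<open>n > 0\<close> by auto
  finally show ?thesis .
qed

lemma sum_by_parts_period:
  fixes u v :: "int \<Rightarrow> real"
  assumes "n > 0" and "\<And>i. u (i + int n) = u i" and "\<And>i. v (i + int n) = v i"
  shows "(\<Sum>i\<in>{1..int n}. (u (i - 1) - 2 * u i + u (i + 1)) * v i)
       = - (\<Sum>i\<in>{1..int n}. (u (i + 1) - u i) * (v (i + 1) - v i))"
proof -
  have sh: "u (i + int n - 1) = u (i - 1)" for i
    using assms(2)[of "i - 1"] by (simp add: algebra_simps)
  have "(\<Sum>i\<in>{1..int n}. (u (i + 1 - 1) - u (i + 1)) * v (i + 1))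
      = (\<Sum>i\<in>{1..int n}. (u (i - 1) - u i) * v i)"
    using sum_shift_period[OF \<open>n > 0\<close>, of "\<lambda>i. (u (i - 1) - u i) * v i"] assms sh by simp
  moreover have "(u (i - 1) - 2 * u i + u (i + 1)) * v i
      = (u (i - 1) - u i) * v i + (u (i + 1) - u i) * v i" for i
    by (simp add: algebra_simps)
  moreover have "- ((u (i + 1) - u i) * (v (i + 1) - v i))
      = (u (i + 1 - 1) - u (i + 1)) * v (i + 1) + (u (i + 1) - u i) * v i" for i
    by (simp add: algebra_simps)
  ultimately show ?thesis
    by (simp add: sum.distrib flip: sum_negf)
qed

lemma period_representative:
  assumes "n > 0"
  obtains i' m where "i' \<in> {1..int n}" and "i = i' + m * int n"
proof
  show "(i - 1) mod int n + 1 \<in> {1..int n}"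
    using assms pos_mod_bound[of "int n" "i - 1"] pos_mod_sign[of "int n" "i - 1"]
    by (simp add: add1_zle_eq)
  show "i = (i - 1) mod int n + 1 + (i - 1) div int n * int n"
    using mod_div_mult_eq[of "i - 1" "int n"] by linarith
qed

section \<open>Periodic grid functions\<close>

lemma periodic_shift:
  "u \<in> periodic_grid_funs N1 N2 \<Longrightarrow> u (i + m * int N1) j = u i j"
  "u \<in> periodic_grid_funs N1 N2 \<Longrightarrow> u i (j + m * int N2) = u i j"
  unfolding periodic_grid_funs_def mem_Collect_eq by (metis add_0_right mult_zero_left)+

lemma periodic_unit_shift:
  assumes "u \<in> periodic_grid_funs N1 N2"
  shows "u (i + int N1) j = u i j" "u i (j + int N2) = u i j"
  using periodic_shift(1)[OF assms, of i 1 j]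
    periodic_shift(2)[OF assms, of i j 1] by simp_all

lemma periodic_grid_funs_add:
  "u \<in> periodic_grid_funs N1 N2 \<Longrightarrow> v \<in> periodic_grid_funs N1 N2
    \<Longrightarrow> (\<lambda>i j. u i j + v i j) \<in> periodic_grid_funs N1 N2"
  by (simp add: periodic_grid_funs_def)

lemma periodic_grid_funs_scale:
  "u \<in> periodic_grid_funs N1 N2 \<Longrightarrow> (\<lambda>i j. c * u i j) \<in> periodic_grid_funs N1 N2"
  by (simp add: periodic_grid_funs_def)

lemma periodic_grid_funs_const: "(\<lambda>i j. c) \<in> periodic_grid_funs N1 N2"
  by (simp add: periodic_grid_funs_def)

lemma periodic_grid_funs_compose:
  "u \<in> periodic_grid_funs N1 N2 \<Longrightarrow> (\<lambda>i j. p (u i j)) \<in> periodic_grid_funs N1 N2"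
  by (simp add: periodic_grid_funs_def)

lemma periodic_grid_funs_sum:
  assumes "\<And>a. a \<in> A \<Longrightarrow> u a \<in> periodic_grid_funs N1 N2"
  shows "(\<lambda>i j. \<Sum>a\<in>A. u a i j) \<in> periodic_grid_funs N1 N2"
  using assms by (simp add: periodic_grid_funs_def)

lemma periodic_grid_funs_translate:
  assumes "u \<in> periodic_grid_funs N1 N2"
  shows "(\<lambda>i j. u (i + a) (j + b)) \<in> periodic_grid_funs N1 N2"
  unfolding periodic_grid_funs_def mem_Collect_eq
proof (intro allI)
  fix k1 k2 m1 m2
  have "u ((k1 + a) + m1 * int N1) ((k2 + b) + m2 * int N2) = u (k1 + a) (k2 + b)"
    using assms unfolding periodic_grid_funs_def by blast
  then show "u (k1 + m1 * int N1 + a) (k2 + m2 * int N2 + b) = u (k1 + a) (k2 + b)"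
    by (simp add: algebra_simps)
qed

lemma periodic_grid_funs_laplacian:
  assumes "u \<in> periodic_grid_funs N1 N2"
  shows "grid_laplacian X1 X2 N1 N2 u \<in> periodic_grid_funs N1 N2"
proof -
  have "u (i + m * int N1 - 1) j = u (i - 1) j" "u (i + m * int N1 + 1) j = u (i + 1) j"
    "u i (j + m * int N2 - 1) = u i (j - 1)" "u i (j + m * int N2 + 1) = u i (j + 1)" for i j m
    using periodic_shift(1)[OF assms, of "i - 1" m j]
      periodic_shift(1)[OF assms, of "i + 1" m j]
      periodic_shift(2)[OF assms, of i "j - 1" m]
      periodic_shift(2)[OF assms, of i "j + 1" m]
    by (simp_all add: algebra_simps)
  then show ?thesis
    by (simp add: periodic_grid_funs_def grid_laplacian_def periodic_shift[OF assms])
qed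

text \<open>
  The Dirichlet form: the grid inner product of the forward difference quotients of \<open>u\<close> and \<open>v\<close>,
  summed over both directions.
\<close>

definition grid_dirichlet :: "real \<Rightarrow> real \<Rightarrow> nat \<Rightarrow> nat \<Rightarrow> grid_fun \<Rightarrow> grid_fun \<Rightarrow> real" where
  "grid_dirichlet X1 X2 N1 N2 u v =
     grid_inner X1 X2 N1 N2 (\<lambda>i j. u (i + 1) j - u i j) (\<lambda>i j. v (i + 1) j - v i j)
       / (mesh_size X1 N1)\<^sup>2
   + grid_inner X1 X2 N1 N2 (\<lambda>i j. u i (j + 1) - u i j) (\<lambda>i j. v i (j + 1) - v i j)
       / (mesh_size X2 N2)\<^sup>2"

text \<open>The periodic extension of the indicator of the grid point \<open>p\<close>, without a mesh factor.\<close>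

definition periodic_delta :: "nat \<Rightarrow> nat \<Rightarrow> int \<times> int \<Rightarrow> grid_fun" where
  "periodic_delta N1 N2 p = (\<lambda>i j.
     if (i - fst p) mod int N1 = 0 \<and> (j - snd p) mod int N2 = 0 then 1 else 0)"

text \<open>
  A rectangular periodic grid. In the abbreviations, \<open>P\<close> is the space of periodic grid functions,
  \<open>S\<close> one period of indices, \<open>ip\<close> the inner product, \<open>lap\<close> the Laplacian, \<open>G\<close> the inverse of the
  negative Laplacian, which first removes the mean of its argument, \<open>dir\<close> the Dirichlet form,
  \<open>cell\<close> the area of a grid cell, and \<open>gmax\<close> the maximum norm.
\<close>

locale periodic_grid =
  fixes X1 X2 :: real and N1 N2 :: nat
  assumes X_pos: "X1 > 0" "X2 > 0" and N_pos: "N1 > 0" "N2 > 0"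
begin

abbreviation P where "P \<equiv> periodic_grid_funs N1 N2"
abbreviation S where "S \<equiv> index_set N1 N2"
abbreviation ip where "ip \<equiv> grid_inner X1 X2 N1 N2"
abbreviation lap where "lap \<equiv> grid_laplacian X1 X2 N1 N2"
abbreviation G where "G \<equiv> inv_neg_laplacian X1 X2 N1 N2"
abbreviation dir where "dir \<equiv> grid_dirichlet X1 X2 N1 N2"
abbreviation \<delta> where "\<delta> \<equiv> periodic_delta N1 N2"
abbreviation area where "area \<equiv> box_area X1 X2"
abbreviation cell where "cell \<equiv> mesh_size X1 N1 * mesh_size X2 N2"
abbreviation gmax where "gmax \<equiv> grid_max_norm N1 N2"

lemma finite_S: "finite S" and S_nonempty: "S \<noteq> {}" and card_S: "card S = N1 * N2"
  using N_pos by (auto simp: index_set_def)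

lemma mesh_pos: "mesh_size X1 N1 > 0" "mesh_size X2 N2 > 0" "cell > 0"
  using X_pos N_pos by (auto simp: mesh_size_def)

lemma area_eq: "area = cell * real (card S)"
proof -
  have "{-X1..X1} \<times> {-X2..X2} = cbox (-X1, -X2) (X1, X2)"
    by (auto simp: cbox_Pair_eq)
  then have "area = 4 * X1 * X2"
    unfolding box_area_def using X_pos
    by (simp add: content_Pair)
  then show ?thesis
    using N_pos by (simp add: card_S mesh_size_def)
qed

lemma area_pos: "area > 0"
  unfolding area_eq using mesh_pos S_nonempty finite_S by (simp add: card_gt_0_iff)

lemma ip_add_left: "ip (\<lambda>i j. u i j + v i j) w = ip u w + ip v w"
  and ip_diff_left: "ip (\<lambda>i j. u i j - v i j) w = ip u w - ip v w"
  and ip_scale_left: "ip (\<lambda>i j. c * u i j) w = c * ip u w"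
  and ip_commute: "ip u v = ip v u"
  by (auto simp: grid_inner_def case_prod_beta algebra_simps sum.distrib sum_subtractf sum_distrib_left)

lemma ip_minus_left: "ip (\<lambda>i j. - u i j) w = - ip u w"
  using ip_scale_left[of "-1" u w] by simp

lemma ip_add_right: "ip w (\<lambda>i j. u i j + v i j) = ip w u + ip w v"
  and ip_diff_right: "ip w (\<lambda>i j. u i j - v i j) = ip w u - ip w v"
  and ip_scale_right: "ip w (\<lambda>i j. c * u i j) = c * ip w u"
  by (metis ip_commute ip_add_left, metis ip_commute ip_diff_left, metis ip_commute ip_scale_left)

lemma ip_one_const: "ip (\<lambda>i j. c) (\<lambda>i j. 1) = c * area"
  by (simp add: grid_inner_def area_eq case_prod_beta)

lemma ip_const_right: "ip u (\<lambda>i j. c) = c * ip u (\<lambda>i j. 1)"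
  using ip_scale_right[of u c "\<lambda>i j. 1"] by simp

lemma ip_mono:
  assumes "\<And>i j. u i j * v i j \<le> w i j * z i j"
  shows "ip u v \<le> ip w z"
  unfolding grid_inner_def using mesh_pos assms
  by (intro mult_left_mono sum_mono) auto

lemma ip_self_nonneg: "ip u u \<ge> 0"
  using ip_mono[of "\<lambda>_ _. 0" "\<lambda>_ _. 0" u u] by (simp add: grid_inner_def)

lemma ip_self_eq_0:
  assumes "ip u u = 0" "(i, j) \<in> S"
  shows "u i j = 0"
proof -
  have "(\<Sum>p\<in>S. u (fst p) (snd p) * u (fst p) (snd p)) = 0"
    using assms mesh_pos by (simp add: grid_inner_def case_prod_beta)
  then have "\<forall>p\<in>S. u (fst p) (snd p) * u (fst p) (snd p) = 0"
    using finite_S by (subst (asm) sum_nonneg_eq_0_iff) auto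
  then show ?thesis using assms(2) by fastforce
qed

lemma representative:
  obtains i' j' where "(i', j') \<in> S" and "\<And>u. u \<in> P \<Longrightarrow> u i j = u i' j'"
proof -
  obtain i' m where i: "i' \<in> {1..int N1}" "i = i' + m * int N1"
    using period_representative[OF N_pos(1)] .
  obtain j' l where j: "j' \<in> {1..int N2}" "j = j' + l * int N2"
    using period_representative[OF N_pos(2)] .
  show ?thesis
  proof (rule that)
    show "(i', j') \<in> S" using i j by (simp add: index_set_def)
    show "u i j = u i' j'" if "u \<in> P" for u
      using periodic_shift[OF that] i j by simp
  qed
qed

lemma P_eqI:
  assumes "u \<in> P" "v \<in> P" "\<And>i j. (i, j) \<in> S \<Longrightarrow> u i j = v i j"
  shows "u = v"
proof (intro ext)
  fix i j show "u i j = v i j" by (metis representative[of i j] assms)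
qed

section \<open>The Dirichlet form and harmonic grid functions\<close>

lemma dir_symm: "dir u v = dir v u"
  by (simp add: grid_dirichlet_def ip_commute)

lemma dir_self_nonneg: "dir u u \<ge> 0"
  by (simp add: grid_dirichlet_def ip_self_nonneg)

text \<open>Summation by parts; there are no boundary terms because of periodicity.\<close>

lemma ip_laplacian:
  assumes u: "u \<in> P" and v: "v \<in> P"
  shows "ip (lap u) v = - dir u v"
proof -
  define h k where "h = (mesh_size X1 N1)\<^sup>2" and "k = (mesh_size X2 N2)\<^sup>2"
  let ?I = "{1..int N1}" and ?J = "{1..int N2}"
  have A: "(\<Sum>i\<in>?I. (u (i - 1) j - 2 * u i j + u (i + 1) j) * v i j)
       = - (\<Sum>i\<in>?I. (u (i + 1) j - u i j) * (v (i + 1) j - v i j))" for j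
    using periodic_unit_shift[OF u] periodic_unit_shift[OF v] N_pos
    by (intro sum_by_parts_period[of N1 "\<lambda>i. u i j" "\<lambda>i. v i j"]) auto
  have B: "(\<Sum>j\<in>?J. (u i (j - 1) - 2 * u i j + u i (j + 1)) * v i j)
       = - (\<Sum>j\<in>?J. (u i (j + 1) - u i j) * (v i (j + 1) - v i j))" for i
    using periodic_unit_shift[OF u] periodic_unit_shift[OF v] N_pos
    by (intro sum_by_parts_period[of N2 "\<lambda>j. u i j" "\<lambda>j. v i j"]) auto
  have ij: "(\<Sum>(i, j)\<in>S. F i j) = (\<Sum>i\<in>?I. \<Sum>j\<in>?J. F i j)"
   and ji: "(\<Sum>(i, j)\<in>S. F i j) = (\<Sum>j\<in>?J. \<Sum>i\<in>?I. F i j)" for F :: "int \<Rightarrow> int \<Rightarrow> real"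
    unfolding index_set_def by (simp add: sum.cartesian_product, subst sum.swap, simp add: sum.cartesian_product)
  have A': "(\<Sum>(i, j)\<in>S. (u (i - 1) j - 2 * u i j + u (i + 1) j) * v i j)
     = - (\<Sum>(i, j)\<in>S. (u (i + 1) j - u i j) * (v (i + 1) j - v i j))"
    unfolding ji A by (simp add: sum_negf)
  have B': "(\<Sum>(i, j)\<in>S. (u i (j - 1) - 2 * u i j + u i (j + 1)) * v i j)
     = - (\<Sum>(i, j)\<in>S. (u i (j + 1) - u i j) * (v i (j + 1) - v i j))"
    unfolding ij B by (simp add: sum_negf)
  have "(\<Sum>(i, j)\<in>S. lap u i j * v i j)
      = (\<Sum>(i, j)\<in>S. (u (i - 1) j - 2 * u i j + u (i + 1) j) * v i j) / h
      + (\<Sum>(i, j)\<in>S. (u i (j - 1) - 2 * u i j + u i (j + 1)) * v i j) / k"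
    unfolding sum_divide_distrib sum.distrib[symmetric]
    by (rule sum.cong[OF refl])
      (simp add: case_prod_beta grid_laplacian_def h_def k_def add_divide_distrib ring_distribs)
  then have "ip (lap u) v = cell *
     (- (\<Sum>(i, j)\<in>S. (u (i + 1) j - u i j) * (v (i + 1) j - v i j)) / h
      + - (\<Sum>(i, j)\<in>S. (u i (j + 1) - u i j) * (v i (j + 1) - v i j)) / k)"
    unfolding A' B' by (simp add: grid_inner_def)
  then show ?thesis
    unfolding grid_inner_def grid_dirichlet_def h_def k_def by (simp add: distrib_left right_diff_distrib del: mult_minus_right add: mult_minus_right)
qed

lemma ip_laplacian_one: "u \<in> P \<Longrightarrow> ip (lap u) (\<lambda>_ _. 1) = 0"
  by (subst ip_laplacian) (auto simp: periodic_grid_funs_const grid_dirichlet_def grid_inner_def)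

text \<open>A harmonic grid function has vanishing Dirichlet form, hence vanishing differences.\<close>

lemma laplacian_kernel_const:
  assumes u: "u \<in> P" and z: "\<And>i j. lap u i j = 0"
  shows "u i j = u 0 0"
proof -
  have "dir u u = - ip (lap u) u" using ip_laplacian[OF u u] by simp
  also have "\<dots> = 0" using z by (simp add: grid_inner_def)
  finally have d: "dir u u = 0" .
  let ?A = "\<lambda>i j. u (i + 1) j - u i j" and ?B = "\<lambda>i j. u i (j + 1) - u i j"
  have "ip ?A ?A / (mesh_size X1 N1)\<^sup>2 = 0" "ip ?B ?B / (mesh_size X2 N2)\<^sup>2 = 0"
    using d ip_self_nonneg[of ?A] ip_self_nonneg[of ?B]
    unfolding grid_dirichlet_def by (smt (verit) divide_nonneg_nonneg zero_le_power2)+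
  then have AB: "ip ?A ?A = 0" "ip ?B ?B = 0" using mesh_pos by auto
  have "?A \<in> P" "?B \<in> P"
    using periodic_grid_funs_add[OF periodic_grid_funs_translate[OF u, of 1 0] periodic_grid_funs_scale[OF u, of "-1"]]
     periodic_grid_funs_add[OF periodic_grid_funs_translate[OF u, of 0 1] periodic_grid_funs_scale[OF u, of "-1"]]
    by simp_all
  then have "?A = (\<lambda>i j. 0)" "?B = (\<lambda>i j. 0)"
    using ip_self_eq_0[OF AB(1)] ip_self_eq_0[OF AB(2)] by (auto intro!: P_eqI periodic_grid_funs_const)
  then have s: "u (i + 1) j = u i j" "u i (j + 1) = u i j" for i j
    by (metis (no_types, lifting) eq_iff_diff_eq_0)+
  have "u i j = u 0 j"
  proof (induction i rule: int_induct[of _ 0])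
    case (step2 i) then show ?case using s(1)[of "i - 1" j] by simp
  qed (auto simp: s)
  also have "u 0 j = u 0 0"
  proof (induction j rule: int_induct[of _ 0])
    case (step2 j) then show ?case using s(2)[of 0 "j - 1"] by simp
  qed (auto simp: s)
  finally show ?thesis .
qed

section \<open>The discrete Poisson equation\<close>

lemma lap_add: "lap (\<lambda>i j. u i j + v i j) i j = lap u i j + lap v i j"
  and lap_scale: "lap (\<lambda>i j. c * u i j) i j = c * lap u i j"
  and lap_diff: "lap (\<lambda>i j. u i j - v i j) i j = lap u i j - lap v i j"
  unfolding grid_laplacian_def add_divide_distrib[symmetric] diff_divide_distrib[symmetric]
  by (simp_all add: add_divide_distrib diff_divide_distrib algebra_simps)

lemma delta_in_P: "\<delta> p \<in> P"
proof -
  have "k + m * int n - a = (k - a) + m * int n" for k m a n by simp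
  then show ?thesis
    by (simp only: periodic_grid_funs_def periodic_delta_def mem_Collect_eq mod_mult_self1)
       simp
qed

lemma delta_on_S:
  assumes "p \<in> S" "(i, j) \<in> S"
  shows "\<delta> p i j = (if p = (i, j) then 1 else 0)"
proof -
  have *: "(a - b) mod int n = 0 \<longleftrightarrow> a = b" if "a \<in> {1..int n}" "b \<in> {1..int n}" for a b n
  proof
    assume "(a - b) mod int n = 0"
    then have "int n dvd a - b" by auto
    then obtain m where m: "a - b = int n * m" by (elim dvdE)
    have "int n > 0" using that by auto
    have "a - b < int n" "- int n < a - b" using that by auto
    then have "int n * m < int n * 1" "int n * (-1) < int n * m"
      unfolding m by simp_all
    then have "m < 1" "-1 < m"
      unfolding mult_less_cancel_left_pos[OF \<open>int n > 0\<close>] .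
    then have "m = 0" by simp
    then show "a = b" using m by simp
  qed simp
  have "(i - fst p) mod int N1 = 0 \<longleftrightarrow> i = fst p" "(j - snd p) mod int N2 = 0 \<longleftrightarrow> j = snd p"
    using assms by (intro *; auto simp: index_set_def)+
  then show ?thesis by (auto simp: periodic_delta_def prod_eq_iff)
qed

lemma sum_delta_on_S:
  assumes "(i, j) \<in> S"
  shows "(\<Sum>p\<in>S. c p * \<delta> p i j) = c (i, j)"
proof -
  have "(\<Sum>p\<in>S. c p * \<delta> p i j) = (\<Sum>p\<in>S. if p = (i, j) then c p else 0)"
    using assms by (intro sum.cong) (auto simp: delta_on_S)
  then show ?thesis using assms finite_S by simp
qed

lemma expand_in_deltas:
  assumes "u \<in> P"
  shows "u = (\<lambda>i j. \<Sum>p\<in>S. u (fst p) (snd p) * \<delta> p i j)"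
  using assms
  by (intro P_eqI periodic_grid_funs_sum periodic_grid_funs_scale delta_in_P)
    (simp_all add: sum_delta_on_S[where c = "\<lambda>p. u (fst p) (snd p)"])

lemma poisson_unique:
  assumes "u \<in> P" "v \<in> P" "ip u (\<lambda>_ _. 1) = ip v (\<lambda>_ _. 1)"
    and "\<And>i j. lap u i j = lap v i j"
  shows "u = v"
proof -
  let ?w = "\<lambda>i j. u i j - v i j"
  have w: "?w \<in> P"
    using periodic_grid_funs_add[OF assms(1) periodic_grid_funs_scale[OF assms(2), of "-1"]] by simp
  have "?w i j = ?w 0 0" for i j
    by (rule laplacian_kernel_const[OF w]) (simp add: lap_diff assms(4))
  then obtain c where c: "u i j - v i j = c" for i j by blast
  have "ip ?w (\<lambda>_ _. 1) = 0"
    unfolding ip_diff_left using assms(3) by simp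
  moreover have "ip ?w (\<lambda>_ _. 1) = c * area"
    unfolding c by (rule ip_one_const)
  ultimately have "c = 0" using area_pos by simp
  then show ?thesis using c by (intro ext) simp
qed

text \<open>
  Existence follows from uniqueness by counting dimensions. Adding the integral \<open>ip u 1\<close> to
  the negative Laplacian makes the operator injective on all of \<open>P\<close>, not only on the mean-zero
  functions, so that it can be treated as an endomorphism of the span of the finitely many periodic
  deltas. Since Laplacians have mean zero, a right-hand side of mean zero forces the integral of the
  solution to vanish, and the added term with it.
\<close>

lemma poisson_solvable:
  assumes g: "g \<in> P" and mean: "ip g (\<lambda>_ _. 1) = 0"
  obtains u where "u \<in> P" "ip u (\<lambda>_ _. 1) = 0" "\<And>i j. - lap u i j = g i j"
proof -
  define sc :: "real \<Rightarrow> grid_fun \<Rightarrow> grid_fun" where "sc = (\<lambda>c u i j. c * u i j)"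
  define T where "T = (\<lambda>u i j. - lap u i j + ip u (\<lambda>_ _. 1))"
  interpret V: vector_space sc
    by standard (auto simp: sc_def fun_eq_iff algebra_simps)
  have plus: "u + v = (\<lambda>i j. u i j + v i j)" for u v :: grid_fun
    by (simp add: fun_eq_iff)
  have sum_ap: "(\<Sum>x\<in>A. f x) i j = (\<Sum>x\<in>A. f x i j)" for A and f :: "int \<times> int \<Rightarrow> grid_fun" and i j
    by (induction A rule: infinite_finite_induct) auto
  have lin: "Vector_Spaces.linear sc sc T"
    unfolding Vector_Spaces.linear_iff
    using V.vector_space_axioms unfolding T_def plus sc_def
    by (simp add: lap_add lap_scale ip_add_left ip_scale_left fun_eq_iff algebra_simps)
  have "V.subspace P"
    unfolding V.subspace_def unfolding plus sc_def
    by (auto simp: zero_fun_def periodic_grid_funs_const periodic_grid_funs_add periodic_grid_funs_scale)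
  moreover have "P \<subseteq> V.span (\<delta> ` S)"
  proof
    fix u assume "u \<in> P"
    then have "u = (\<Sum>p\<in>S. sc (u (fst p) (snd p)) (\<delta> p))"
      by (subst expand_in_deltas) (auto simp: fun_eq_iff sum_ap sc_def)
    moreover have "(\<Sum>p\<in>S. sc (u (fst p) (snd p)) (\<delta> p)) \<in> V.span (\<delta> ` S)"
      by (intro V.span_sum V.span_scale V.span_base) auto
    ultimately show "u \<in> V.span (\<delta> ` S)" by simp
  qed
  ultimately have span: "V.span (\<delta> ` S) = P"
    using V.span_minimal[of "\<delta> ` S" P] delta_in_P by blast
  have T_one: "ip (T u) (\<lambda>_ _. 1) = ip u (\<lambda>_ _. 1) * area" if "u \<in> P" for u
    unfolding T_def ip_add_left ip_minus_left ip_one_const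
    using ip_laplacian_one[OF that] by simp
  have "T u \<in> P" if "u \<in> P" for u
    using periodic_grid_funs_scale[OF periodic_grid_funs_laplacian[OF that], of "-1"]
    unfolding T_def by (intro periodic_grid_funs_add periodic_grid_funs_const) simp
  moreover have "inj_on T P"
  proof (rule inj_onI)
    fix u v assume uv: "u \<in> P" "v \<in> P" "T u = T v"
    then have "ip u (\<lambda>_ _. 1) = ip v (\<lambda>_ _. 1)"
      using T_one[of u] T_one[of v] area_pos by simp
    moreover from this have "lap u i j = lap v i j" for i j
      using fun_cong[OF fun_cong[OF uv(3)], of i j] unfolding T_def by simp
    ultimately show "u = v" using uv by (intro poisson_unique)
  qed
  ultimately have "T ` P = P"
    using V.linear_inj_on_span_imp_surj[OF _ lin, of "\<delta> ` S"] finite_S unfolding span by blast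
  then obtain u where u: "u \<in> P" "T u = g" using g by (metis imageE)
  have "ip u (\<lambda>_ _. 1) = 0"
    using T_one[OF u(1)] u(2) mean area_pos by simp
  moreover from this have "- lap u i j = g i j" for i j
    using fun_cong[OF fun_cong[OF u(2)], of i j] unfolding T_def by simp
  ultimately show ?thesis using that u(1) by blast
qed

text \<open>
  With solvability and uniqueness, the definite description that defines \<open>G\<close> is meaningful for every
  periodic right-hand side.
\<close>

lemma G_eqI:
  assumes "u \<in> P" "ip u (\<lambda>_ _. 1) = 0"
    and "\<And>i j. - lap u i j = g i j - ip g (\<lambda>_ _. 1) / area"
  shows "G g = u"
  unfolding inv_neg_laplacian_def
proof (rule the_equality)
  show "u \<in> P \<and> ip u (\<lambda>_ _. 1) = 0 \<and> (\<forall>i j. - lap u i j = g i j - ip g (\<lambda>_ _. 1) / area)"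
    using assms by blast
next
  fix v assume v: "v \<in> P \<and> ip v (\<lambda>_ _. 1) = 0 \<and> (\<forall>i j. - lap v i j = g i j - ip g (\<lambda>_ _. 1) / area)"
  show "v = u"
  proof (rule poisson_unique)
    show "lap v i j = lap u i j" for i j
      using v assms(3)[of i j] by (metis neg_equal_iff_equal)
  qed (use v assms in auto)
qed

lemma
  assumes g: "g \<in> P"
  shows G_in_P: "G g \<in> P" and G_mean_zero: "ip (G g) (\<lambda>_ _. 1) = 0"
    and G_laplacian: "- lap (G g) i j = g i j - ip g (\<lambda>_ _. 1) / area"
proof -
  let ?m = "ip g (\<lambda>_ _. 1) / area"
  have "(\<lambda>i j. g i j + - ?m) \<in> P"
    by (intro periodic_grid_funs_add g periodic_grid_funs_const)
  moreover have "ip (\<lambda>i j. g i j + - ?m) (\<lambda>_ _. 1) = 0"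
    unfolding ip_add_left using area_pos by (simp add: ip_one_const)
  ultimately obtain u where u: "u \<in> P" "ip u (\<lambda>_ _. 1) = 0" "\<And>i j. - lap u i j = g i j + - ?m"
    by (metis (no_types, lifting) poisson_solvable)
  have "G g = u" using u by (intro G_eqI) auto
  then show "G g \<in> P" "ip (G g) (\<lambda>_ _. 1) = 0" "- lap (G g) i j = g i j - ?m"
    using u by auto
qed

lemma G_add:
  assumes "u \<in> P" "v \<in> P"
  shows "G (\<lambda>i j. u i j + v i j) = (\<lambda>i j. G u i j + G v i j)"
proof (rule G_eqI)
  show "- lap (\<lambda>i j. G u i j + G v i j) i j
      = u i j + v i j - ip (\<lambda>i j. u i j + v i j) (\<lambda>_ _. 1) / area" for i j
    using G_laplacian[OF assms(1), of i j] G_laplacian[OF assms(2), of i j]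
    by (simp add: lap_add ip_add_left add_divide_distrib)
qed (use assms in \<open>auto simp: G_in_P periodic_grid_funs_add ip_add_left G_mean_zero\<close>)

lemma G_scale:
  assumes "u \<in> P"
  shows "G (\<lambda>i j. c * u i j) = (\<lambda>i j. c * G u i j)"
proof (rule G_eqI)
  show "- lap (\<lambda>i j. c * G u i j) i j = c * u i j - ip (\<lambda>i j. c * u i j) (\<lambda>_ _. 1) / area" for i j
    using arg_cong[OF G_laplacian[OF assms, of i j], of "\<lambda>x. c * x"]
    by (simp add: lap_scale ip_scale_left algebra_simps)
qed (use assms in \<open>auto simp: G_in_P periodic_grid_funs_scale ip_scale_left G_mean_zero\<close>)

lemma G_sum:
  assumes "finite A" "\<And>a. a \<in> A \<Longrightarrow> v a \<in> P"
  shows "G (\<lambda>i j. \<Sum>a\<in>A. c a * v a i j) = (\<lambda>i j. \<Sum>a\<in>A. c a * G (v a) i j)"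
  using assms
proof (induction A rule: finite_induct)
  case empty
  show ?case using G_scale[OF periodic_grid_funs_const, of 0 0] by simp
next
  case (insert a A)
  then show ?case
    by (simp add: G_add G_scale periodic_grid_funs_scale periodic_grid_funs_sum)
qed

lemma G_symmetric:
  assumes u: "u \<in> P" and v: "v \<in> P"
  shows "ip (G u) v = ip u (G v)"
proof -
  have main: "ip (G u) v = dir (G u) (G v)" if "u \<in> P" "v \<in> P" for u v
  proof -
    have "v = (\<lambda>i j. - lap (G v) i j + ip v (\<lambda>_ _. 1) / area)"
      using G_laplacian[OF that(2)] by simp
    then have "ip (G u) v = ip (\<lambda>i j. - lap (G v) i j + ip v (\<lambda>_ _. 1) / area) (G u)"
      by (metis ip_commute)
    also have "\<dots> = - ip (lap (G v)) (G u) + ip (G u) (\<lambda>i j. ip v (\<lambda>_ _. 1) / area)"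
      by (simp only: ip_add_left ip_minus_left) (simp add: ip_commute)
    also have "\<dots> = dir (G u) (G v)"
      using that ip_const_right[of "G u"] by (simp add: ip_laplacian G_in_P G_mean_zero dir_symm)
    finally show ?thesis .
  qed
  show ?thesis
    using main[OF u v] main[OF v u] by (simp add: dir_symm ip_commute)
qed

section \<open>The kernel of the inverse Laplacian and its norm\<close>

lemma G_kernel:
  assumes "g \<in> P"
  shows "G g i j = (\<Sum>p\<in>S. g (fst p) (snd p) * G (\<delta> p) i j)"
  by (subst expand_in_deltas[OF assms]) (simp add: G_sum[OF finite_S delta_in_P])

lemma ip_delta:
  assumes "p \<in> S"
  shows "ip u (\<delta> p) = cell * u (fst p) (snd p)"
proof -
  have "(\<Sum>q\<in>S. u (fst q) (snd q) * \<delta> p (fst q) (snd q)) = (\<Sum>q\<in>S. if q = p then u (fst q) (snd q) else 0)"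
    using assms by (intro sum.cong) (auto simp: delta_on_S)
  then show ?thesis using assms finite_S by (simp add: grid_inner_def case_prod_beta)
qed

lemma G_kernel_symmetric:
  assumes "p \<in> S" "q \<in> S"
  shows "G (\<delta> p) (fst q) (snd q) = G (\<delta> q) (fst p) (snd p)"
  using G_symmetric[OF delta_in_P delta_in_P, of p q] ip_delta[OF assms(2), of "G (\<delta> p)"]
    ip_delta[OF assms(1), of "G (\<delta> q)"] mesh_pos by (simp add: ip_commute)

lemma gmax_le_iff: "gmax u \<le> c \<longleftrightarrow> (\<forall>(i, j)\<in>S. \<bar>u i j\<bar> \<le> c)"
  unfolding grid_max_norm_def using finite_S S_nonempty by (auto simp: Max_le_iff)

lemma abs_le_gmax: "u \<in> P \<Longrightarrow> \<bar>u i j\<bar> \<le> gmax u"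
  using gmax_le_iff[of u "gmax u"] by (metis (no_types, lifting) case_prod_conv order_refl representative)

lemma gmax_nonneg: "gmax u \<ge> 0"
proof -
  obtain p where "p \<in> S" using S_nonempty by auto
  then have "\<bar>u (fst p) (snd p)\<bar> \<le> gmax u"
    using gmax_le_iff[of u "gmax u"] by (auto simp: case_prod_beta)
  then show ?thesis by linarith
qed

text \<open>The optimal constant of \<open>G\<close> in the maximum norm.\<close>

abbreviation L where "L \<equiv> inv_neg_laplacian_norm X1 X2 N1 N2"

text \<open>Some bound exists, so the optimal constant is an infimum over a nonempty set.\<close>

lemma G_bounded: "\<exists>C. \<forall>g\<in>P. gmax (G g) \<le> C * gmax g"
proof (intro exI ballI)
  fix g assume g: "g \<in> P"
  let ?C = "\<Sum>q\<in>S. \<Sum>p\<in>S. \<bar>G (\<delta> p) (fst q) (snd q)\<bar>"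
  have "\<bar>G g i j\<bar> \<le> ?C * gmax g" if "(i, j) \<in> S" for i j
  proof -
    have "\<bar>G g i j\<bar> \<le> (\<Sum>p\<in>S. \<bar>g (fst p) (snd p) * G (\<delta> p) i j\<bar>)"
      unfolding G_kernel[OF g, of i j] by (rule sum_abs)
    also have "\<dots> \<le> (\<Sum>p\<in>S. gmax g * \<bar>G (\<delta> p) i j\<bar>)"
      unfolding abs_mult by (intro sum_mono mult_right_mono abs_le_gmax g) auto
    also have "\<dots> = (\<Sum>p\<in>S. \<bar>G (\<delta> p) (fst (i, j)) (snd (i, j))\<bar>) * gmax g"
      by (simp add: sum_distrib_left mult.commute)
    also have "\<dots> \<le> ?C * gmax g"
      by (intro mult_right_mono gmax_nonneg member_le_sum[OF that]) (auto simp: finite_S sum_nonneg)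
    finally show ?thesis .
  qed
  then show "gmax (G g) \<le> ?C * gmax g" by (auto simp: gmax_le_iff)
qed

text \<open>The optimal constant is itself admissible.\<close>

lemma gmax_G_le:
  assumes g: "g \<in> P"
  shows "gmax (G g) \<le> L * gmax g"
proof -
  define A where "A = {C. \<forall>g\<in>P. gmax (G g) \<le> C * gmax g}"
  obtain C where C: "C \<in> A" using G_bounded by (auto simp: A_def)
  show ?thesis
  proof (cases "gmax g = 0")
    case True
    then show ?thesis using C g by (auto simp: A_def)
  next
    case False
    then have pos: "gmax g > 0" using gmax_nonneg[of g] by simp
    have "gmax (G g) / gmax g \<le> Inf A"
      by (rule cInf_greatest) (use C g pos in \<open>auto simp: A_def pos_divide_le_eq\<close>)
    then show ?thesis
      using pos by (simp add: pos_divide_le_eq inv_neg_laplacian_norm_def A_def)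
  qed
qed

lemma L_nonneg: "L \<ge> 0"
proof -
  have "gmax (\<lambda>_ _. 1) = 1"
    using abs_le_gmax[OF periodic_grid_funs_const, of 1] by (intro antisym) (auto simp: gmax_le_iff)
  then show ?thesis
    using gmax_G_le[OF periodic_grid_funs_const, of 1] gmax_nonneg[of "G (\<lambda>_ _. 1)"] by simp
qed

text \<open>
  The absolute row sums of the kernel are bounded by the operator norm: apply \<open>G\<close> to the periodic
  function of signs of the row.
\<close>

lemma kernel_row_sum_le:
  assumes q: "(i, j) \<in> S"
  shows "(\<Sum>p\<in>S. \<bar>G (\<delta> p) i j\<bar>) \<le> L"
proof -
  define s where "s = (\<lambda>i' j'. \<Sum>p\<in>S. sgn (G (\<delta> p) i j) * \<delta> p i' j')"
  have s: "s \<in> P"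
    unfolding s_def by (intro periodic_grid_funs_sum periodic_grid_funs_scale delta_in_P)
  have "gmax s \<le> 1"
    by (auto simp: gmax_le_iff s_def sum_delta_on_S abs_sgn_eq)
  have "(\<Sum>p\<in>S. \<bar>G (\<delta> p) i j\<bar>) = (\<Sum>p\<in>S. sgn (G (\<delta> p) i j) * G (\<delta> p) i j)"
    by (simp only: abs_sgn mult.commute)
  also have "\<dots> = G s i j"
    unfolding s_def by (simp add: G_sum[OF finite_S delta_in_P])
  also have "\<dots> \<le> gmax (G s)"
    using abs_le_gmax[OF G_in_P[OF s], of i j] by linarith
  also have "\<dots> \<le> L * gmax s" by (rule gmax_G_le[OF s])
  also have "\<dots> \<le> L * 1" using L_nonneg \<open>gmax s \<le> 1\<close> by (intro mult_left_mono)
  finally show ?thesis by simp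
qed

text \<open>The optimal constant for the maximum norm also bounds the quadratic form of \<open>G\<close>.\<close>

lemma ip_G_self_le:
  assumes F: "F \<in> P"
  shows "ip (G F) F \<le> L * ip F F"
proof -
  have "(\<Sum>q\<in>S. (\<Sum>p\<in>S. F (fst p) (snd p) * G (\<delta> p) (fst q) (snd q)) * F (fst q) (snd q))
      \<le> L * (\<Sum>q\<in>S. F (fst q) (snd q) * F (fst q) (snd q))"
    by (rule schur_test_symmetric[where k = "\<lambda>p q. G (\<delta> p) (fst q) (snd q)"])
       (auto intro: G_kernel_symmetric kernel_row_sum_le)
  then have "cell * (\<Sum>q\<in>S. G F (fst q) (snd q) * F (fst q) (snd q))
      \<le> cell * (L * (\<Sum>q\<in>S. F (fst q) (snd q) * F (fst q) (snd q)))"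
    using mesh_pos by (intro mult_left_mono) (auto simp: G_kernel[OF F])
  then show ?thesis by (simp add: grid_inner_def case_prod_beta mult_ac)
qed

lemma ip_one_square_le: "(ip F (\<lambda>_ _. 1))\<^sup>2 \<le> area * ip F F"
proof -
  have "(\<Sum>p\<in>S. F (fst p) (snd p) * 1)\<^sup>2 \<le> (\<Sum>p\<in>S. (F (fst p) (snd p))\<^sup>2) * (\<Sum>p\<in>S. 1\<^sup>2)"
    by (rule Cauchy_Schwarz_ineq_sum)
  then have "cell\<^sup>2 * (\<Sum>p\<in>S. F (fst p) (snd p))\<^sup>2
      \<le> cell\<^sup>2 * ((\<Sum>p\<in>S. F (fst p) (snd p) * F (fst p) (snd p)) * real (card S))"
    by (intro mult_left_mono) (simp_all add: power2_eq_square)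
  then show ?thesis
    unfolding grid_inner_def area_eq
    by (simp add: case_prod_beta power_mult_distrib power2_eq_square mult_ac)
qed

section \<open>Discrete maximum principle and energy identities\<close>

lemma discrete_max_principle:
  assumes u: "u \<in> P" and "a > 0" "e \<ge> 0"
    and le: "\<And>i j. a * u i j - e * lap u i j \<le> a * c"
  shows "u i j \<le> c"
proof -
  let ?v = "\<lambda>(i, j). u i j"
  have "Max (?v ` S) \<in> ?v ` S"
    using finite_S S_nonempty by (intro Max_in) auto
  then obtain k l where kl: "(k, l) \<in> S" "u k l = Max (?v ` S)" by auto
  have max: "u i j \<le> u k l" for i j
  proof -
    obtain i' j' where "(i', j') \<in> S" "u i j = u i' j'" using representative[of i j] u by metis
    then show ?thesis using kl finite_S by (auto intro!: Max_ge)
  qed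
  have "lap u k l \<le> 0"
    unfolding grid_laplacian_def
    using max[of "k - 1" l] max[of "k + 1" l] max[of k "l - 1"] max[of k "l + 1"]
    by (intro add_nonpos_nonpos[OF divide_nonpos_nonneg divide_nonpos_nonneg] zero_le_power2; linarith)
  then have "e * lap u k l \<le> 0" using \<open>e \<ge> 0\<close> by (simp add: mult_nonneg_nonpos)
  then have "a * u k l \<le> a * c" using le[of k l] by linarith
  then have "u k l \<le> c" using \<open>a > 0\<close> by simp
  then show ?thesis using max[of i j] by linarith
qed

lemma ip_mult_one: "ip (\<lambda>i j. u i j * v i j) (\<lambda>_ _. 1) = ip u v"
  by (simp add: grid_inner_def)

lemma ip_le_of_pointwise:
  assumes "\<And>i j. u i j * v i j \<le> w i j * z i j + c * (d i j * d i j)"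
  shows "ip u v \<le> ip w z + c * ip d d"
proof -
  have "ip u v \<le> ip (\<lambda>i j. w i j * z i j + c * (d i j * d i j)) (\<lambda>_ _. 1)"
    using assms by (intro ip_mono) simp
  also have "\<dots> = ip w z + c * ip d d"
    by (simp only: ip_add_left ip_scale_left ip_mult_one)
  finally show ?thesis .
qed

text \<open>
  The quadratic form of the negative Laplacian lies above its tangent at the new state \<open>u\<close>. This is
  why the implicit treatment of the diffusion needs no stabilization.
\<close>

lemma dirichlet_energy_convex:
  assumes u: "u \<in> P" and v: "v \<in> P"
  shows "ip (lap u) u - ip (lap v) v \<ge> 2 * ip (lap u) (\<lambda>i j. u i j - v i j)"
proof -
  let ?d = "\<lambda>i j. u i j - v i j"
  have d: "?d \<in> P"
    using periodic_grid_funs_add[OF u periodic_grid_funs_scale[OF v, of "-1"]] by simp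
  have "ip (lap v) u = ip (lap u) v"
    using u v by (simp add: ip_laplacian dir_symm)
  moreover have "ip (lap ?d) ?d \<le> 0"
    using ip_laplacian[OF d d] dir_self_nonneg[of ?d] by simp
  moreover have "ip (lap ?d) ?d = ip (lap u) u - ip (lap u) v - (ip (lap v) u - ip (lap v) v)"
    unfolding lap_diff ip_diff_left ip_diff_right by simp
  moreover have "2 * ip (lap u) ?d = 2 * ip (lap u) u - 2 * ip (lap u) v"
    by (simp add: ip_diff_right)
  ultimately show ?thesis by linarith
qed

lemma quadratic_G_add:
  assumes u: "u \<in> P" and v: "v \<in> P"
  shows "ip (G (\<lambda>i j. u i j + v i j)) (\<lambda>i j. u i j + v i j)
    = ip (G u) u + 2 * ip (G u) v + ip (G v) v"
  using G_symmetric[OF u v] unfolding G_add[OF u v] ip_add_left ip_add_right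
  by (simp add: ip_commute)

end

section \<open>The potentials on the unit interval\<close>

lemma deriv_W_fun: "deriv W_fun = (\<lambda>s. 36 * (2 * s ^ 3 - 3 * s\<^sup>2 + s))"
  unfolding W_fun_def
  by (intro ext DERIV_imp_deriv)
    (auto intro!: derivative_eq_intros simp: power2_eq_square power3_eq_cube algebra_simps)

lemma deriv_deriv_W_fun: "deriv (deriv W_fun) = (\<lambda>s. 36 * (6 * s\<^sup>2 - 6 * s + 1))"
  unfolding deriv_W_fun
  by (intro ext DERIV_imp_deriv)
    (auto intro!: derivative_eq_intros simp: power2_eq_square algebra_simps)

lemma deriv_f_fun: "deriv f_fun = (\<lambda>s. 6 * s - 6 * s\<^sup>2)"
  unfolding f_fun_def
  by (intro ext DERIV_imp_deriv)
    (auto intro!: derivative_eq_intros simp: power2_eq_square algebra_simps)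

lemma deriv_deriv_f_fun: "deriv (deriv f_fun) = (\<lambda>s. 6 - 12 * s)"
  unfolding deriv_f_fun
  by (intro ext DERIV_imp_deriv) (auto intro!: derivative_eq_intros simp: algebra_simps)

lemma W_fun_has_derivative: "(W_fun has_real_derivative deriv W_fun s) (at s)"
  unfolding deriv_W_fun unfolding W_fun_def
  by (auto intro!: derivative_eq_intros simp: power2_eq_square power3_eq_cube algebra_simps)

lemma deriv_W_fun_has_derivative:
  "(deriv W_fun has_real_derivative deriv (deriv W_fun) s) (at s)"
  unfolding deriv_deriv_W_fun unfolding deriv_W_fun
  by (auto intro!: derivative_eq_intros simp: power2_eq_square algebra_simps)

lemma f_fun_has_derivative: "(f_fun has_real_derivative deriv f_fun s) (at s)"
  unfolding deriv_f_fun unfolding f_fun_def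
  by (auto intro!: derivative_eq_intros simp: power2_eq_square algebra_simps)

lemma deriv_f_fun_has_derivative:
  "(deriv f_fun has_real_derivative deriv (deriv f_fun) s) (at s)"
  unfolding deriv_deriv_f_fun unfolding deriv_f_fun
  by (auto intro!: derivative_eq_intros simp: algebra_simps)

lemma f_fun_in_01:
  assumes "0 \<le> s" "s \<le> 1"
  shows "0 \<le> f_fun s" "f_fun s \<le> 1"
proof -
  have "f_fun s = s\<^sup>2 * (3 - 2 * s)" "1 - f_fun s = (1 - s)\<^sup>2 * (1 + 2 * s)"
    by (simp_all add: f_fun_def power2_eq_square power3_eq_cube algebra_simps)
  moreover have "s\<^sup>2 * (3 - 2 * s) \<ge> 0" "(1 - s)\<^sup>2 * (1 + 2 * s) \<ge> 0"
    using assms by simp_all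
  ultimately show "0 \<le> f_fun s" "f_fun s \<le> 1" by linarith+
qed

lemma abs_le_sup_norm_01:
  assumes "continuous_on {0..1} g" "0 \<le> s" "s \<le> 1"
  shows "\<bar>g s\<bar> \<le> sup_norm_01 g"
proof -
  have "compact ((\<lambda>s. \<bar>g s\<bar>) ` {0..1})"
    using assms(1) by (intro compact_continuous_image continuous_intros) auto
  then have "bdd_above ((\<lambda>s. \<bar>g s\<bar>) ` {0..1})"
    by (intro bounded_imp_bdd_above compact_imp_bounded)
  then show ?thesis
    unfolding sup_norm_01_def using assms by (intro cSUP_upper) auto
qed

lemma sup_norm_01_nonneg:
  "continuous_on {0..1} g \<Longrightarrow> sup_norm_01 g \<ge> 0"
  using abs_le_sup_norm_01[of g 0] by simp

lemma taylor_remainder_le: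
  fixes g g' g'' :: "real \<Rightarrow> real"
  assumes d: "\<And>s. (g has_real_derivative g' s) (at s)" "\<And>s. (g' has_real_derivative g'' s) (at s)"
    and K: "\<And>s. \<lbrakk>0 \<le> s; s \<le> 1\<rbrakk> \<Longrightarrow> \<bar>g'' s\<bar> \<le> K"
    and ab: "0 \<le> a" "a \<le> 1" "0 \<le> b" "b \<le> 1"
  shows "\<bar>g b - g a - g' a * (b - a)\<bar> \<le> K / 2 * (b - a)\<^sup>2"
proof (cases "a = b")
  case False
  define D where "D = (\<lambda>m::nat. if m = 0 then g else if m = 1 then g' else g'')"
  have "\<exists>t. (if b < a then b < t \<and> t < a else a < t \<and> t < b) \<and>
    g b = (\<Sum>m<2. (D m a / fact m) * (b - a)^m) + (D 2 t / fact 2) * (b - a)^2"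
    using ab False d by (intro Taylor[of 2 D g 0 1]) (auto simp: D_def less_2_cases_iff)
  then obtain t where t: "if b < a then b < t \<and> t < a else a < t \<and> t < b"
    "g b = g a + g' a * (b - a) + g'' t / 2 * (b - a)\<^sup>2"
    by (auto simp: D_def numeral_2_eq_2)
  then have t01: "0 \<le> t" "t \<le> 1" using ab by (auto split: if_splits)
  have "\<bar>g b - g a - g' a * (b - a)\<bar> = \<bar>g'' t\<bar> / 2 * (b - a)\<^sup>2"
    using t(2) by (simp add: abs_mult)
  also have "\<dots> \<le> K / 2 * (b - a)\<^sup>2"
    using K[OF t01] by (intro mult_right_mono) auto
  finally show ?thesis .
qed simp

lemma lipschitz_01:
  fixes g g' :: "real \<Rightarrow> real"
  assumes d: "\<And>s. (g has_real_derivative g' s) (at s)"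
    and K: "\<And>s. \<lbrakk>0 \<le> s; s \<le> 1\<rbrakk> \<Longrightarrow> \<bar>g' s\<bar> \<le> K"
    and ab: "0 \<le> a" "a \<le> 1" "0 \<le> b" "b \<le> 1"
  shows "\<bar>g b - g a\<bar> \<le> K * \<bar>b - a\<bar>"
  using field_differentiable_bound[of "{0..1}" g g' K b a] assms
  by (auto intro: has_field_derivative_at_within)

text \<open>The constants \<open>L\<^bsub>W''\<^esub>\<close>, \<open>L\<^bsub>f'\<^esub>\<close> and \<open>L\<^bsub>f''\<^esub>\<close>.\<close>

abbreviation LW where "LW \<equiv> sup_norm_01 (deriv (deriv W_fun))"
abbreviation Lf1 where "Lf1 \<equiv> sup_norm_01 (deriv f_fun)"
abbreviation Lf2 where "Lf2 \<equiv> sup_norm_01 (deriv (deriv f_fun))"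

lemma continuous_on_derivs:
  "continuous_on {0..1} (deriv (deriv W_fun))" "continuous_on {0..1} (deriv f_fun)"
  "continuous_on {0..1} (deriv (deriv f_fun))"
  by (unfold deriv_deriv_W_fun deriv_deriv_f_fun, unfold deriv_f_fun) (intro continuous_intros)+

lemmas LW_bound = abs_le_sup_norm_01[OF continuous_on_derivs(1)]
lemmas Lf1_bound = abs_le_sup_norm_01[OF continuous_on_derivs(2)]
lemmas Lf2_bound = abs_le_sup_norm_01[OF continuous_on_derivs(3)]
lemmas Lf2_nonneg = sup_norm_01_nonneg[OF continuous_on_derivs(3)]

lemma W_fun_taylor:
  assumes "0 \<le> a" "a \<le> 1" "0 \<le> b" "b \<le> 1"
  shows "W_fun b - W_fun a \<le> deriv W_fun a * (b - a) + LW / 2 * (b - a)\<^sup>2"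
proof -
  have "\<bar>W_fun b - W_fun a - deriv W_fun a * (b - a)\<bar> \<le> LW / 2 * (b - a)\<^sup>2"
    using assms LW_bound
    by (intro taylor_remainder_le[where g'' = "deriv (deriv W_fun)"])
       (simp_all add: W_fun_has_derivative deriv_W_fun_has_derivative)
  then show ?thesis by linarith
qed

lemma f_fun_taylor:
  assumes "0 \<le> a" "a \<le> 1" "0 \<le> b" "b \<le> 1"
  shows "\<bar>f_fun b - f_fun a - deriv f_fun a * (b - a)\<bar> \<le> Lf2 / 2 * (b - a)\<^sup>2"
  using assms Lf2_bound
  by (intro taylor_remainder_le[where g'' = "deriv (deriv f_fun)"])
     (simp_all add: f_fun_has_derivative deriv_f_fun_has_derivative)

lemma f_fun_lipschitz:
  assumes "0 \<le> a" "a \<le> 1" "0 \<le> b" "b \<le> 1"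
  shows "\<bar>f_fun b - f_fun a\<bar> \<le> Lf1 * \<bar>b - a\<bar>"
  using assms Lf1_bound
  by (intro lipschitz_01[where g' = "deriv f_fun"]) (simp_all add: f_fun_has_derivative)

text \<open>
  With the nonlocal coefficient \<open>c\<close> held constant, the explicit part of the scheme is a nondecreasing
  function of \<open>s\<close>, and the first derivatives of \<open>W\<close> and \<open>f\<close> vanish at \<open>0\<close> and \<open>1\<close>. So it maps
  \<open>[0,1]\<close> into \<open>[0,k]\<close>.
\<close>

lemma explicit_term_in_range:
  assumes e: "e > 0" and k: "LW / e + \<bar>c\<bar> * Lf2 \<le> k" and s: "0 \<le> s" "s \<le> 1"
  shows "0 \<le> k * s - 1 / e * deriv W_fun s - c * deriv f_fun s"
    and "k * s - 1 / e * deriv W_fun s - c * deriv f_fun s \<le> k"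
proof -
  let ?g = "\<lambda>s. k * s - 1 / e * deriv W_fun s - c * deriv f_fun s"
  have der: "(?g has_real_derivative k - 1 / e * deriv (deriv W_fun) s - c * deriv (deriv f_fun) s) (at s)" for s
    by (intro DERIV_diff DERIV_cmult DERIV_cmult_Id deriv_W_fun_has_derivative
        deriv_f_fun_has_derivative)
  have pos: "k - 1 / e * deriv (deriv W_fun) s - c * deriv (deriv f_fun) s \<ge> 0"
    if "0 \<le> s" "s \<le> 1" for s
  proof -
    have "1 / e * deriv (deriv W_fun) s \<le> LW / e"
      using LW_bound[OF that] e by (simp add: divide_right_mono)
    moreover have "c * deriv (deriv f_fun) s \<le> \<bar>c\<bar> * Lf2"
      using mult_left_mono[OF Lf2_bound[OF that], of "\<bar>c\<bar>"]
        abs_ge_self[of "c * deriv (deriv f_fun) s"] by (simp add: abs_mult)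
    ultimately show ?thesis using k by linarith
  qed
  have mono: "?g a \<le> ?g b" if "0 \<le> a" "a \<le> b" "b \<le> 1" for a b
    by (rule DERIV_nonneg_imp_nondecreasing[OF that(2)]) (use der pos that in fastforce)
  show "0 \<le> ?g s" using mono[of 0 s] s by (simp add: deriv_W_fun deriv_f_fun)
  show "?g s \<le> k" using mono[of s 1] s by (simp add: deriv_W_fun deriv_f_fun)
qed

section \<open>One step of the scheme\<close>

text \<open>
  The parameters of the scheme with the stability condition, which does not involve the step size
  \<open>\<tau>\<close>; \<open>E\<close> is the discrete energy.
\<close>

locale pOK_scheme = periodic_grid X1 X2 N1 N2
  for X1 X2 :: real and N1 N2 :: nat +
  fixes \<epsilon> \<gamma> M \<omega> \<kappa> \<tau> :: real
  assumes par: "\<epsilon> > 0" "\<gamma> > 0" "M > 0" "\<kappa> > 0" "0 < \<omega>" "\<omega> < 1" "\<tau> > 0"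
    and stab: "LW / \<epsilon> + (Lf1\<^sup>2 + max \<omega> (1 - \<omega>) * Lf2)
             * (\<gamma> * inv_neg_laplacian_norm X1 X2 N1 N2 + M * box_area X1 X2) \<le> \<kappa> / \<epsilon>"
begin

abbreviation \<omega>t where "\<omega>t \<equiv> max \<omega> (1 - \<omega>)"
abbreviation E where "E \<equiv> pOK_energy X1 X2 N1 N2 \<epsilon> \<gamma> M \<omega>"
abbreviation step where "step \<equiv> pOK_step X1 X2 N1 N2 \<epsilon> \<gamma> M \<omega> \<kappa> \<tau>"

context
  fixes \<Phi> :: grid_fun
  assumes \<Phi>: "\<Phi> \<in> P" and range: "\<And>i j. 0 \<le> \<Phi> i j" "\<And>i j. \<Phi> i j \<le> 1"
begin

text \<open>The deviation of the phase density from its prescribed mean \<open>\<omega>\<close>.\<close>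

abbreviation g where "g \<equiv> \<lambda>i j. f_fun (\<Phi> i j) - \<omega>"

lemma g_in_P: "g \<in> P"
  using periodic_grid_funs_compose[OF \<Phi>, of "\<lambda>s. f_fun s - \<omega>"] .

lemma abs_g_le: "\<bar>g i j\<bar> \<le> \<omega>t"
  using f_fun_in_01[OF range, of i j] by linarith

text \<open>
  The nonlocal coefficient of \<open>f'\<close> in the scheme has a part from the Poisson potential and one from
  the mass; both are bounded because the current state takes values in \<open>[0,1]\<close>.
\<close>

lemma potential_bound: "\<bar>G g i j\<bar> \<le> L * \<omega>t"
proof -
  have "\<bar>G g i j\<bar> \<le> gmax (G g)" by (rule abs_le_gmax[OF G_in_P[OF g_in_P]])
  also have "\<dots> \<le> L * gmax g" by (rule gmax_G_le[OF g_in_P])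
  also have "\<dots> \<le> L * \<omega>t"
    using L_nonneg abs_g_le by (intro mult_left_mono) (auto simp: gmax_le_iff)
  finally show ?thesis .
qed

lemma mass_bound: "\<bar>ip g (\<lambda>_ _. 1)\<bar> \<le> area * \<omega>t"
proof -
  have "ip g (\<lambda>_ _. 1) \<le> \<omega>t * area" "- ip g (\<lambda>_ _. 1) \<le> \<omega>t * area"
    unfolding ip_one_const[symmetric] ip_minus_left[symmetric]
    using abs_g_le by (intro ip_mono; simp add: abs_le_iff)+
  then show ?thesis by (simp add: abs_le_iff mult.commute)
qed

lemma stab_range: "LW / \<epsilon> + \<bar>\<gamma> * G g i j + M * ip g (\<lambda>_ _. 1)\<bar> * Lf2 \<le> \<kappa> / \<epsilon>"
proof -
  let ?K = "\<gamma> * L + M * area"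
  have "\<bar>\<gamma> * G g i j + M * ip g (\<lambda>_ _. 1)\<bar> \<le> \<gamma> * \<bar>G g i j\<bar> + M * \<bar>ip g (\<lambda>_ _. 1)\<bar>"
    using abs_triangle_ineq[of "\<gamma> * G g i j" "M * ip g (\<lambda>_ _. 1)"] par by (simp add: abs_mult)
  also have "\<dots> \<le> \<gamma> * (L * \<omega>t) + M * (area * \<omega>t)"
    using par by (intro add_mono mult_left_mono potential_bound mass_bound) auto
  finally have "\<bar>\<gamma> * G g i j + M * ip g (\<lambda>_ _. 1)\<bar> * Lf2 \<le> (\<gamma> * (L * \<omega>t) + M * (area * \<omega>t)) * Lf2"
    using Lf2_nonneg by (intro mult_right_mono)
  \<comment> \<open>The range is controlled by the terms with \<open>LW\<close> and \<open>Lf2\<close>; the term with \<open>Lf1\<close> is slack here.\<close>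
  moreover have "Lf1\<^sup>2 * ?K \<ge> 0"
    using par L_nonneg area_pos by simp
  ultimately show ?thesis using stab by (simp add: algebra_simps)
qed

context
  fixes \<Psi> :: grid_fun
  assumes \<Psi>: "\<Psi> \<in> P" and st: "step \<Phi> \<Psi>"
begin

lemma step_eq:
  "(1 / \<tau> + \<kappa> / \<epsilon>) * (\<Psi> i j - \<Phi> i j) =
     \<epsilon> * lap \<Psi> i j - 1 / \<epsilon> * deriv W_fun (\<Phi> i j)
     - \<gamma> * (G g i j * deriv f_fun (\<Phi> i j))
     - M * ip g (\<lambda>_ _. 1) * deriv f_fun (\<Phi> i j)"
  using st unfolding pOK_step_def by (simp add: mult.assoc)

lemma step_preserves_range: "0 \<le> \<Psi> i j" "\<Psi> i j \<le> 1"
proof -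
  let ?a = "1 / \<tau> + \<kappa> / \<epsilon>"
  have a: "?a > 0" using par by (simp add: add_pos_pos)
  \<comment> \<open>The implicit operator on the left, the explicit part in the form of
    \<open>explicit_term_in_range\<close> on the right.\<close>
  have eq: "?a * \<Psi> i j - \<epsilon> * lap \<Psi> i j
    = \<Phi> i j / \<tau> + (\<kappa> / \<epsilon> * \<Phi> i j - 1 / \<epsilon> * deriv W_fun (\<Phi> i j)
        - (\<gamma> * G g i j + M * ip g (\<lambda>_ _. 1)) * deriv f_fun (\<Phi> i j))" for i j
    using step_eq[of i j] by (simp add: algebra_simps)
  have tau: "0 \<le> \<Phi> i j / \<tau>" "\<Phi> i j / \<tau> \<le> 1 / \<tau>" for i j
    using range par by (auto intro: divide_right_mono)
  note ex = explicit_term_in_range[OF par(1) stab_range range]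
  show "\<Psi> i j \<le> 1"
  proof (rule discrete_max_principle[OF \<Psi> a, of \<epsilon>])
    show "?a * \<Psi> i j - \<epsilon> * lap \<Psi> i j \<le> ?a * 1" for i j
      unfolding eq mult_1_right by (rule add_mono[OF tau(2) ex(2)])
  qed (use par in simp)
  have "- \<Psi> i j \<le> 0"
  proof (rule discrete_max_principle[OF _ a, of "\<lambda>i j. - \<Psi> i j" \<epsilon>])
    have "?a * \<Psi> i j - \<epsilon> * lap \<Psi> i j \<ge> 0" for i j
      unfolding eq using tau(1)[of i j] ex(1)[of i j i j] by linarith
    moreover have "lap (\<lambda>i j. - \<Psi> i j) i j = - lap \<Psi> i j" for i j
      using lap_scale[of "-1" \<Psi> i j] by simp
    ultimately show "?a * - \<Psi> i j - \<epsilon> * lap (\<lambda>i j. - \<Psi> i j) i j \<le> ?a * 0" for i j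
      by (simp add: algebra_simps)
  qed (use par periodic_grid_funs_scale[OF \<Psi>, of "-1"] in auto)
  then show "0 \<le> \<Psi> i j" by simp
qed

text \<open>
  The energy balance of one step. The inner products of the increment \<open>D\<close> with the terms of the scheme
  cancel against the first-order terms of the energy difference. What remains is bounded by a
  multiple of \<open>\<parallel>D\<parallel>\<^sup>2\<close>; the stability condition makes it nonpositive, with a factor 2 to spare.
\<close>

lemma step_energy_le: "E \<Psi> \<le> E \<Phi>"
proof -
  define D where "D = (\<lambda>i j. \<Psi> i j - \<Phi> i j)"
  define F where "F = (\<lambda>i j. f_fun (\<Psi> i j) - f_fun (\<Phi> i j))"
  define Q where "Q = ip D D"
  define W' where "W' = (\<lambda>i j. deriv W_fun (\<Phi> i j))"
  define f' where "f' = (\<lambda>i j. deriv f_fun (\<Phi> i j))"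
  define A where "A = G g"
  define B where "B = ip g (\<lambda>_ _. 1)"
  note rng = range step_preserves_range
  have F: "F \<in> P" unfolding F_def
    using periodic_grid_funs_add[OF periodic_grid_funs_compose[OF \<Psi>, of f_fun]
        periodic_grid_funs_compose[OF \<Phi>, of "\<lambda>s. - f_fun s"]] by simp
  have Q: "Q \<ge> 0" unfolding Q_def by (rule ip_self_nonneg)

  have elliptic: "- \<epsilon> / 2 * (ip (lap \<Psi>) \<Psi> - ip (lap \<Phi>) \<Phi>) \<le> - \<epsilon> * ip (lap \<Psi>) D"
    using mult_left_mono[OF dirichlet_energy_convex[OF \<Psi> \<Phi>], of "\<epsilon> / 2"] par(1)
    by (simp add: D_def algebra_simps)

  have well: "ip (\<lambda>i j. W_fun (\<Psi> i j)) (\<lambda>_ _. 1) - ip (\<lambda>i j. W_fun (\<Phi> i j)) (\<lambda>_ _. 1)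
      \<le> ip W' D + LW / 2 * Q"
    unfolding ip_diff_left[symmetric] Q_def
    using W_fun_taylor[OF rng]
    by (intro ip_le_of_pointwise) (simp add: W'_def D_def power2_eq_square)

  have rem: "\<bar>F i j - f' i j * D i j\<bar> \<le> Lf2 / 2 * (D i j * D i j)" for i j
    using f_fun_taylor[OF rng] by (simp add: F_def f'_def D_def power2_eq_square)
  \<comment> \<open>Linearization of \<open>c * F\<close>; it is used with the potential and with the mass as \<open>c\<close>.\<close>
  have lin: "c * F i j \<le> c * f' i j * D i j + K * (Lf2 / 2) * (D i j * D i j)"
    if "\<bar>c\<bar> \<le> K" for c K i j
  proof -
    have "c * (F i j - f' i j * D i j) \<le> \<bar>c\<bar> * \<bar>F i j - f' i j * D i j\<bar>"
      using abs_ge_self[of "c * (F i j - f' i j * D i j)"] by (simp add: abs_mult)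
    also have "\<dots> \<le> K * (Lf2 / 2 * (D i j * D i j))"
      using that by (intro mult_mono rem) auto
    finally show ?thesis by (simp add: algebra_simps)
  qed
  have FF: "ip F F \<le> Lf1\<^sup>2 * Q"
  proof -
    have "F i j * F i j \<le> Lf1\<^sup>2 * (D i j * D i j)" for i j
    proof -
      have "\<bar>F i j\<bar> \<le> Lf1 * \<bar>D i j\<bar>"
        using f_fun_lipschitz[OF rng] by (simp add: F_def D_def)
      then have "\<bar>F i j\<bar>\<^sup>2 \<le> (Lf1 * \<bar>D i j\<bar>)\<^sup>2" by (intro power_mono) auto
      then show ?thesis by (simp only: power_mult_distrib power2_abs) (simp add: power2_eq_square)
    qed
    then have "ip F F \<le> ip (\<lambda>_ _. 0) (\<lambda>_ _. 0) + Lf1\<^sup>2 * ip D D"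
      by (intro ip_le_of_pointwise) simp
    then show ?thesis by (simp add: Q_def grid_inner_def)
  qed

  have g': "(\<lambda>i j. f_fun (\<Psi> i j) - \<omega>) = (\<lambda>i j. g i j + F i j)"
    by (simp add: F_def fun_eq_iff)

  have "ip A F \<le> ip (\<lambda>i j. A i j * f' i j) D + L * \<omega>t * (Lf2 / 2) * Q"
    unfolding Q_def using lin[OF potential_bound]
    by (intro ip_le_of_pointwise) (simp add: A_def)
  moreover have "ip (G F) F \<le> L * (Lf1\<^sup>2 * Q)"
    using ip_G_self_le[OF F] mult_left_mono[OF FF L_nonneg] by linarith
  ultimately have "ip (G (\<lambda>i j. g i j + F i j)) (\<lambda>i j. g i j + F i j) - ip A g
      \<le> 2 * ip (\<lambda>i j. A i j * f' i j) D + L * (\<omega>t * Lf2 + Lf1\<^sup>2) * Q"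
    unfolding quadratic_G_add[OF g_in_P F] A_def by (simp add: algebra_simps)
  then have nonlocal: "\<gamma> / 2 * (ip (G (\<lambda>i j. g i j + F i j)) (\<lambda>i j. g i j + F i j) - ip A g)
      \<le> \<gamma> / 2 * (2 * ip (\<lambda>i j. A i j * f' i j) D + L * (\<omega>t * Lf2 + Lf1\<^sup>2) * Q)"
    using par by (intro mult_left_mono) auto

  have "ip (\<lambda>i j. B * F i j) (\<lambda>_ _. 1)
      \<le> ip (\<lambda>i j. B * f' i j) D + area * \<omega>t * (Lf2 / 2) * ip D D"
    using lin[OF mass_bound] by (intro ip_le_of_pointwise) (simp add: B_def)
  then have "B * ip F (\<lambda>_ _. 1) \<le> B * ip f' D + area * \<omega>t * (Lf2 / 2) * Q"
    unfolding ip_scale_left Q_def .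
  moreover have "(ip F (\<lambda>_ _. 1))\<^sup>2 \<le> area * (Lf1\<^sup>2 * Q)"
    using ip_one_square_le[of F] mult_left_mono[OF FF, of area] area_pos by linarith
  ultimately have "(ip (\<lambda>i j. g i j + F i j) (\<lambda>_ _. 1))\<^sup>2 - B\<^sup>2
      \<le> 2 * (B * ip f' D) + area * (\<omega>t * Lf2 + Lf1\<^sup>2) * Q"
    unfolding ip_add_left B_def[symmetric] power2_sum by (simp add: algebra_simps)
  then have mass: "M / 2 * ((ip (\<lambda>i j. g i j + F i j) (\<lambda>_ _. 1))\<^sup>2 - B\<^sup>2)
      \<le> M / 2 * (2 * (B * ip f' D) + area * (\<omega>t * Lf2 + Lf1\<^sup>2) * Q)"
    using par by (intro mult_left_mono) auto

  \<comment> \<open>The scheme tested with the increment.\<close>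
  have "(\<lambda>i j. (1 / \<tau> + \<kappa> / \<epsilon>) * D i j) = (\<lambda>i j. \<epsilon> * lap \<Psi> i j - 1 / \<epsilon> * W' i j
      - \<gamma> * (A i j * f' i j) - M * B * f' i j)"
    using step_eq by (simp add: D_def W'_def f'_def A_def B_def)
  then have "ip (\<lambda>i j. (1 / \<tau> + \<kappa> / \<epsilon>) * D i j) D = ip (\<lambda>i j. \<epsilon> * lap \<Psi> i j - 1 / \<epsilon> * W' i j
      - \<gamma> * (A i j * f' i j) - M * B * f' i j) D" by simp
  then have tested: "(1 / \<tau> + \<kappa> / \<epsilon>) * Q = \<epsilon> * ip (lap \<Psi>) D - 1 / \<epsilon> * ip W' D
      - \<gamma> * ip (\<lambda>i j. A i j * f' i j) D - M * B * ip f' D"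
    unfolding ip_diff_left ip_scale_left Q_def .

  have "E \<Psi> - E \<Phi> = - \<epsilon> / 2 * (ip (lap \<Psi>) \<Psi> - ip (lap \<Phi>) \<Phi>)
      + 1 / \<epsilon> * (ip (\<lambda>i j. W_fun (\<Psi> i j)) (\<lambda>_ _. 1) - ip (\<lambda>i j. W_fun (\<Phi> i j)) (\<lambda>_ _. 1))
      + \<gamma> / 2 * (ip (G (\<lambda>i j. g i j + F i j)) (\<lambda>i j. g i j + F i j) - ip A g)
      + M / 2 * ((ip (\<lambda>i j. g i j + F i j) (\<lambda>_ _. 1))\<^sup>2 - B\<^sup>2)"
    unfolding pOK_energy_def g' A_def B_def by (simp add: algebra_simps diff_divide_distrib)
  also have "\<dots> \<le> - \<epsilon> * ip (lap \<Psi>) D + 1 / \<epsilon> * (ip W' D + LW / 2 * Q)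
      + \<gamma> / 2 * (2 * ip (\<lambda>i j. A i j * f' i j) D + L * (\<omega>t * Lf2 + Lf1\<^sup>2) * Q)
      + M / 2 * (2 * (B * ip f' D) + area * (\<omega>t * Lf2 + Lf1\<^sup>2) * Q)"
    using par well by (intro add_mono elliptic nonlocal mass mult_left_mono) auto
  also have "\<dots> = - (1 / \<tau> + \<kappa> / \<epsilon>) * Q
      + (LW / \<epsilon> + (Lf1\<^sup>2 + \<omega>t * Lf2) * (\<gamma> * L + M * area)) / 2 * Q"
    using tested by (simp add: algebra_simps add_divide_distrib)
  also have "\<dots> \<le> - (1 / \<tau> + \<kappa> / \<epsilon>) * Q + (\<kappa> / \<epsilon>) / 2 * Q"
    using stab Q by (intro add_left_mono mult_right_mono divide_right_mono) auto
  also have "\<dots> = - (1 / \<tau> + \<kappa> / \<epsilon> / 2) * Q" by (simp add: algebra_simps)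
  also have "\<dots> \<le> 0"
    unfolding mult_minus_left neg_le_0_iff_le using par Q by (intro mult_nonneg_nonneg) auto
  finally show ?thesis by simp
qed

end
end
end

section \<open>Energy stability\<close>

theorem theorem4p2:
  fixes X1 X2 \<epsilon> \<gamma> M \<omega> \<kappa> T \<tau> :: real
    and N1 N2 N :: nat
    and \<Phi> :: "nat \<Rightarrow> grid_fun"
  assumes "X1 > 0" "X2 > 0"
    and "N1 > 0" "even N1" "N2 > 0" "even N2"
    and "\<epsilon> > 0" "\<gamma> > 0" "M > 0" "\<kappa> > 0" "0 < \<omega>" "\<omega> < 1"
    and "T > 0" "N > 0" "\<tau> = T / real N"
    and "\<forall>n\<le>N. \<Phi> n \<in> periodic_grid_funs N1 N2"
    and "\<forall>n<N. pOK_step X1 X2 N1 N2 \<epsilon> \<gamma> M \<omega> \<kappa> \<tau> (\<Phi> n) (\<Phi> (Suc n))"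
    and "\<forall>i j. 0 \<le> \<Phi> 0 i j \<and> \<Phi> 0 i j \<le> 1"
    and "\<kappa> / \<epsilon> \<ge> sup_norm_01 (deriv (deriv W_fun)) / \<epsilon>
           + ((sup_norm_01 (deriv f_fun))\<^sup>2 + max \<omega> (1 - \<omega>) * sup_norm_01 (deriv (deriv f_fun)))
             * (\<gamma> * inv_neg_laplacian_norm X1 X2 N1 N2 + M * box_area X1 X2)"
  shows "\<forall>n<N. pOK_energy X1 X2 N1 N2 \<epsilon> \<gamma> M \<omega> (\<Phi> (Suc n))
               \<le> pOK_energy X1 X2 N1 N2 \<epsilon> \<gamma> M \<omega> (\<Phi> n)"
proof -
  interpret pOK_scheme X1 X2 N1 N2 \<epsilon> \<gamma> M \<omega> \<kappa> \<tau>
    using assms by unfold_locales auto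
  have range: "n \<le> N \<Longrightarrow> \<forall>i j. 0 \<le> \<Phi> n i j \<and> \<Phi> n i j \<le> 1" for n
  proof (induction n)
    case 0
    show ?case by (fact assms(18))
  next
    case (Suc n)
    then show ?case
      using step_preserves_range[of "\<Phi> n" "\<Phi> (Suc n)"] assms(16,17) by simp
  qed
  show ?thesis
    using step_energy_le range assms(16,17) by simp
qed

end
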